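(* Let $E$ be a separable Banach space which is an absolute Lipschitz retract and contains an isomorphic copy of $c_0$. If a metric space $M$ contains a bilipschitz copy of the unit sphere $S_E$ of $E$, then there is a continuous linear surjection from the Banach space $\mathrm{Lip}_0(M)$ onto $\ell_1$.
   Context: All vector spaces are real. For a metric space $(M,\rho)$ with a distinguished base point $e$, $\mathrm{Lip}_0(M)$ is the Banach space of all Lipschitz functions $f\colon M\to\mathbb{R}$ with $f(e)=0$, with norm $\|f\|=\mathrm{Lip}(f)=\sup_{x\neq y}|f(x)-f(y)|/\rho(x,y)$. A metric space is an absolute Lipschitz retract if it is a Lipschitz retract of every metric space containing it; equivalently, a metric space $Q$ is an absolute Lipschitz retract if for all metric spaces $P\subseteq N$ every Lipschitz mapping $P\to Q$ has a Lipschitz extension $N\to Q$. $S_E=\{x\in E\colon\|x\|=1\}$ carries the metric induced by the norm. *)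

theory Defs
  imports "HOL-Analysis.Analysis"
begin

section \<open>The sequence spaces \<open>c\<^sub>0\<close> and \<open>\<ell>\<^sub>1\<close>\<close>

typedef c0 = "{x :: nat \<Rightarrow> real. x \<longlonglongrightarrow> 0}"
  morphisms c0_nth Abs_c0
  by (intro exI[of _ "\<lambda>_. 0"]) auto

setup_lifting type_definition_c0

lemma bdd_above_c0: "bdd_above (range (\<lambda>n. \<bar>c0_nth x n\<bar>))"
proof -
  have "Bseq (c0_nth x)"
    using c0_nth[of x] by (auto intro!: convergent_imp_Bseq simp: convergent_def)
  then show ?thesis
    by (auto simp: Bseq_def bdd_above_def)
qed

instantiation c0 :: real_normed_vector
begin

lift_definition zero_c0 :: c0 is "\<lambda>_. 0" by simp
lift_definition plus_c0 :: "c0 \<Rightarrow> c0 \<Rightarrow> c0" is "\<lambda>x y n. x n + y n"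
  by (auto intro: tendsto_add_zero)
lift_definition minus_c0 :: "c0 \<Rightarrow> c0 \<Rightarrow> c0" is "\<lambda>x y n. x n - y n"
  using tendsto_diff[of _ "0::real" _ _ 0] by auto
lift_definition uminus_c0 :: "c0 \<Rightarrow> c0" is "\<lambda>x n. - x n"
  using tendsto_minus[of _ "0::real"] by auto
lift_definition scaleR_c0 :: "real \<Rightarrow> c0 \<Rightarrow> c0" is "\<lambda>c x n. c * x n"
  by (auto intro: tendsto_mult_right_zero)
definition norm_c0 :: "c0 \<Rightarrow> real" where "norm_c0 x = (SUP n. \<bar>c0_nth x n\<bar>)"
definition sgn_c0 :: "c0 \<Rightarrow> c0" where "sgn_c0 x = inverse (norm x) *\<^sub>R x"
definition dist_c0 :: "c0 \<Rightarrow> c0 \<Rightarrow> real" where "dist_c0 x y = norm (x - y)"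
definition uniformity_c0 :: "(c0 \<times> c0) filter"
  where "uniformity_c0 = (INF e\<in>{0<..}. principal {(x, y). dist x y < e})"
definition open_c0 :: "c0 set \<Rightarrow> bool"
  where "open_c0 U \<longleftrightarrow> (\<forall>x\<in>U. \<forall>\<^sub>F (x', y) in uniformity. x' = x \<longrightarrow> y \<in> U)"

instance
proof
  fix a b :: real and x y z :: c0 and U :: "c0 set"
  show "x + y + z = x + (y + z)" "x + y = y + x" "0 + x = x" "- x + x = 0" "x - y = x + - y"
    "a *\<^sub>R (x + y) = a *\<^sub>R x + a *\<^sub>R y" "(a + b) *\<^sub>R x = a *\<^sub>R x + b *\<^sub>R x"
    "a *\<^sub>R (b *\<^sub>R x) = (a * b) *\<^sub>R x" "1 *\<^sub>R x = x"
    by (transfer; simp add: algebra_simps)+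
  show "sgn x = inverse (norm x) *\<^sub>R x" by (fact sgn_c0_def)
  show "dist x y = norm (x - y)" by (fact dist_c0_def)
  show "uniformity = (INF e\<in>{0<..}. principal {(x :: c0, y). dist x y < e})"
    by (fact uniformity_c0_def)
  show "open U \<longleftrightarrow> (\<forall>x\<in>U. \<forall>\<^sub>F (x', y) in uniformity. x' = x \<longrightarrow> y \<in> U)"
    by (fact open_c0_def)
  have le: "\<bar>c0_nth x n\<bar> \<le> norm x" for x n
    unfolding norm_c0_def by (rule cSUP_upper[OF _ bdd_above_c0]) simp
  show "norm x = 0 \<longleftrightarrow> x = 0"
  proof
    assume "norm x = 0"
    then have "c0_nth x n = 0" for n
      using le[of x n] by simp
    then show "x = 0"
      by transfer auto
  next
    assume "x = 0"
    then have "c0_nth x n = 0" for n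
      by transfer simp
    then show "norm x = 0"
      by (simp add: norm_c0_def)
  qed
  show "norm (x + y) \<le> norm x + norm y"
    unfolding norm_c0_def[of "x + y"]
  proof (rule cSUP_least)
    fix n show "\<bar>c0_nth (x + y) n\<bar> \<le> norm x + norm y"
      using le[of x n] le[of y n] by (simp add: plus_c0.rep_eq)
  qed simp
  have up: "norm (a *\<^sub>R x) \<le> \<bar>a\<bar> * norm x" for a and x :: c0
    unfolding norm_c0_def[of "a *\<^sub>R x"]
    by (rule cSUP_least) (auto simp: scaleR_c0.rep_eq abs_mult intro!: mult_left_mono le)
  show "norm (a *\<^sub>R x) = \<bar>a\<bar> * norm x"
  proof (cases "a = 0")
    case True
    then show ?thesis
      using up[of 0 x] le[of "0 *\<^sub>R x" 0] by simp
  next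
    case False
    have "inverse a *\<^sub>R (a *\<^sub>R x) = x"
      using False by transfer (simp add: field_simps)
    then have "norm x = norm (inverse a *\<^sub>R (a *\<^sub>R x))"
      by simp
    also have "\<dots> \<le> \<bar>inverse a\<bar> * norm (a *\<^sub>R x)"
      by (rule up)
    finally have "\<bar>a\<bar> * norm x \<le> norm (a *\<^sub>R x)"
      using False by (simp add: field_simps)
    with up[of a x] show ?thesis
      by simp
  qed
qed

end

typedef ell1 = "{x :: nat \<Rightarrow> real. summable (\<lambda>n. \<bar>x n\<bar>)}"
  morphisms ell1_nth Abs_ell1
  by (intro exI[of _ "\<lambda>_. 0"]) auto

setup_lifting type_definition_ell1

instantiation ell1 :: real_normed_vector
begin

lift_definition zero_ell1 :: ell1 is "\<lambda>_. 0" by simp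
lift_definition plus_ell1 :: "ell1 \<Rightarrow> ell1 \<Rightarrow> ell1" is "\<lambda>x y n. x n + y n"
  subgoal for x y
    by (rule summable_comparison_test'[of "\<lambda>n. \<bar>x n\<bar> + \<bar>y n\<bar>" 0]) (auto intro: summable_add)
  done
lift_definition minus_ell1 :: "ell1 \<Rightarrow> ell1 \<Rightarrow> ell1" is "\<lambda>x y n. x n - y n"
  subgoal for x y
    by (rule summable_comparison_test'[of "\<lambda>n. \<bar>x n\<bar> + \<bar>y n\<bar>" 0]) (auto intro: summable_add)
  done
lift_definition uminus_ell1 :: "ell1 \<Rightarrow> ell1" is "\<lambda>x n. - x n" by simp
lift_definition scaleR_ell1 :: "real \<Rightarrow> ell1 \<Rightarrow> ell1" is "\<lambda>c x n. c * x n"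
  by (simp add: abs_mult summable_mult)
definition norm_ell1 :: "ell1 \<Rightarrow> real" where "norm_ell1 x = (\<Sum>n. \<bar>ell1_nth x n\<bar>)"
definition sgn_ell1 :: "ell1 \<Rightarrow> ell1" where "sgn_ell1 x = inverse (norm x) *\<^sub>R x"
definition dist_ell1 :: "ell1 \<Rightarrow> ell1 \<Rightarrow> real" where "dist_ell1 x y = norm (x - y)"
definition uniformity_ell1 :: "(ell1 \<times> ell1) filter"
  where "uniformity_ell1 = (INF e\<in>{0<..}. principal {(x, y). dist x y < e})"
definition open_ell1 :: "ell1 set \<Rightarrow> bool"
  where "open_ell1 U \<longleftrightarrow> (\<forall>x\<in>U. \<forall>\<^sub>F (x', y) in uniformity. x' = x \<longrightarrow> y \<in> U)"

instance
proof
  fix a b :: real and x y z :: ell1 and U :: "ell1 set"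
  have s: "summable (\<lambda>n. \<bar>ell1_nth x n\<bar>)" for x
    using ell1_nth[of x] by simp
  show "x + y + z = x + (y + z)" "x + y = y + x" "0 + x = x" "- x + x = 0" "x - y = x + - y"
    "a *\<^sub>R (x + y) = a *\<^sub>R x + a *\<^sub>R y" "(a + b) *\<^sub>R x = a *\<^sub>R x + b *\<^sub>R x"
    "a *\<^sub>R (b *\<^sub>R x) = (a * b) *\<^sub>R x" "1 *\<^sub>R x = x"
    by (transfer; simp add: algebra_simps)+
  show "sgn x = inverse (norm x) *\<^sub>R x" by (fact sgn_ell1_def)
  show "dist x y = norm (x - y)" by (fact dist_ell1_def)
  show "uniformity = (INF e\<in>{0<..}. principal {(x :: ell1, y). dist x y < e})"
    by (fact uniformity_ell1_def)
  show "open U \<longleftrightarrow> (\<forall>x\<in>U. \<forall>\<^sub>F (x', y) in uniformity. x' = x \<longrightarrow> y \<in> U)"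
    by (fact open_ell1_def)
  show "norm x = 0 \<longleftrightarrow> x = 0"
    unfolding norm_ell1_def suminf_eq_zero_iff[OF s abs_ge_zero]
    by transfer auto
  show "norm (x + y) \<le> norm x + norm y"
    unfolding norm_ell1_def suminf_add[OF s s]
    by (rule suminf_le[OF _ s summable_add[OF s s]]) (simp add: plus_ell1.rep_eq)
  show "norm (a *\<^sub>R x) = \<bar>a\<bar> * norm x"
    by (simp add: norm_ell1_def scaleR_ell1.rep_eq abs_mult suminf_mult[OF s])
qed

end


section \<open>Isomorphic and bilipschitz copies\<close>

definition contains_isomorphic_copy_c0 :: "'e::real_normed_vector itself \<Rightarrow> bool" where
  "contains_isomorphic_copy_c0 _ \<longleftrightarrow>
     (\<exists>(T :: c0 \<Rightarrow> 'e) S. bounded_linear T \<and> homeomorphism UNIV (range T) T S)"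

definition bilipschitz_on :: "'a::metric_space set \<Rightarrow> ('a \<Rightarrow> 'b::metric_space) \<Rightarrow> bool" where
  "bilipschitz_on S h \<longleftrightarrow>
     (\<exists>a>0. \<exists>b>0. \<forall>x\<in>S. \<forall>y\<in>S. a * dist x y \<le> dist (h x) (h y) \<and> dist (h x) (h y) \<le> b * dist x y)"


section \<open>Absolute Lipschitz retracts\<close>

text \<open>
  \<open>Q\<close> is a Lipschitz retract of every metric space \<open>N\<close> that contains it, where containment is
  expressed by an isometric embedding \<open>i\<close> of \<open>Q\<close> into \<open>N\<close>.  A formula cannot quantify over the
  metric spaces of all types, so \<open>N\<close> ranges over the metric spaces whose points are functions
  \<open>'a \<Rightarrow> real\<close>.  This is no restriction: the Kuratowski embedding places \<open>Q\<close> in the space of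
  bounded real functions on \<open>Q\<close>, which is such a space, and
  \<open>absolute_lipschitz_retract_extension\<close> and \<open>absolute_lipschitz_retract_retraction\<close> below derive
  the extension and the retraction property for metric spaces over an arbitrary type.
\<close>

definition absolute_lipschitz_retract :: "'a metric \<Rightarrow> bool" where
  "absolute_lipschitz_retract Q \<longleftrightarrow>
     (\<forall>(N :: ('a \<Rightarrow> real) metric) i.
        i \<in> mspace Q \<rightarrow> mspace N \<and>
        (\<forall>x\<in>mspace Q. \<forall>y\<in>mspace Q. mdist N (i x) (i y) = mdist Q x y) \<longrightarrow>
        (\<exists>r. Lipschitz_continuous_map N (submetric N (i ` mspace Q)) r \<and>
             (\<forall>x\<in>i ` mspace Q. r x = x)))"

lemma mdist_refl: "x \<in> mspace Q \<Longrightarrow> mdist Q x x = 0"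
  by simp

lemma kuratowski:
  fixes Q :: "'a metric"
  assumes "q0 \<in> mspace Q"
  defines "K \<equiv> \<lambda>q. restrict (\<lambda>x. mdist Q q x - mdist Q q0 x) (mspace Q)"
  shows "K \<in> mspace Q \<rightarrow> mspace (funspace (mspace Q) (euclidean_metric :: real metric))"
    and "\<And>x y. x \<in> mspace Q \<Longrightarrow> y \<in> mspace Q \<Longrightarrow>
           mdist (funspace (mspace Q) (euclidean_metric :: real metric)) (K x) (K y) = mdist Q x y"
proof -
  let ?N = "funspace (mspace Q) (euclidean_metric :: real metric)"
  have tri: "\<bar>mdist Q q x - mdist Q q' x\<bar> \<le> mdist Q q q'"
    if "q \<in> mspace Q" "q' \<in> mspace Q" "x \<in> mspace Q" for q q' x
    using mdist_triangle[of q Q q' x] mdist_triangle[of q' Q q x] that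
    by (auto simp: mdist_commute abs_le_iff)
  show K: "K \<in> mspace Q \<rightarrow> mspace ?N"
  proof
    fix q assume q: "q \<in> mspace Q"
    have "bounded (K q ` mspace Q)"
      unfolding bounded_iff
      using tri[OF q assms(1)] by (auto simp: K_def intro!: exI[of _ "mdist Q q q0"])
    then show "K q \<in> mspace ?N"
      by (simp add: Metric_space.fspace_def[OF Met_TC.Metric_space_axioms] K_def)
  qed
  fix x y assume xy: "x \<in> mspace Q" "y \<in> mspace Q"
  have KN: "K x \<in> mspace ?N" "K y \<in> mspace ?N"
    using K xy by auto
  note le = funspace_mdist_le[OF KN]
  have ne: "mspace Q \<noteq> {}"
    using assms(1) by auto
  show "mdist ?N (K x) (K y) = mdist Q x y"
  proof (rule antisym)
    show "mdist ?N (K x) (K y) \<le> mdist Q x y"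
      unfolding le[OF ne] using tri[OF xy] by (auto simp: K_def dist_real_def)
    have "\<forall>z\<in>mspace Q. mdist euclidean_metric (K x z) (K y z) \<le> mdist ?N (K x) (K y)"
      using le[OF ne, of "mdist ?N (K x) (K y)"] by simp
    from this[rule_format, OF xy(2)] show "mdist Q x y \<le> mdist ?N (K x) (K y)"
      using xy by (simp add: K_def dist_real_def mdist_refl del: mdist_funspace)
  qed
qed

lemma absolute_lipschitz_retract_extension:
  fixes Q :: "'a metric" and N :: "'n metric"
  assumes Q: "absolute_lipschitz_retract Q" "mspace Q \<noteq> {}"
    and P: "P \<subseteq> mspace N"
    and f: "Lipschitz_continuous_map (submetric N P) Q f"
  shows "\<exists>g. Lipschitz_continuous_map N Q g \<and> (\<forall>x\<in>P. g x = f x)"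
proof (cases "P = {}")
  case True
  from Q(2) obtain q where "q \<in> mspace Q"
    by blast
  with True show ?thesis
    by (intro exI[of _ "\<lambda>_. q"]) (simp add: Lipschitz_continuous_map_const)
next
  case False
  obtain q0 where q0: "q0 \<in> mspace Q"
    using Q(2) by blast
  let ?L = "funspace (mspace Q) (euclidean_metric :: real metric)"
  define K where "K = (\<lambda>q. restrict (\<lambda>x. mdist Q q x - mdist Q q0 x) (mspace Q))"
  have K1: "K \<in> mspace Q \<rightarrow> mspace ?L"
    and K2: "\<And>x y. x \<in> mspace Q \<Longrightarrow> y \<in> mspace Q \<Longrightarrow> mdist ?L (K x) (K y) = mdist Q x y"
    using kuratowski[OF q0] unfolding K_def by blast+
  obtain r where r: "Lipschitz_continuous_map ?L (submetric ?L (K ` mspace Q)) r"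
    and rid: "\<And>q. q \<in> mspace Q \<Longrightarrow> r (K q) = K q"
    using Q(1)[unfolded absolute_lipschitz_retract_def, rule_format, of K ?L] K1 K2 by auto
  have fP: "f x \<in> mspace Q" if "x \<in> P" for x
    using Lipschitz_continuous_map_image[OF f] that P by auto
  obtain B where B: "B > 0"
    "\<And>x y. x \<in> P \<Longrightarrow> y \<in> P \<Longrightarrow> mdist Q (f x) (f y) \<le> B * mdist N x y"
    using f P unfolding Lipschitz_continuous_map_pos by (auto simp: subset_iff)
  have Kf: "\<bar>K (f p) x - K (f p') x\<bar> \<le> B * mdist N p p'"
    if "p \<in> P" "p' \<in> P" "x \<in> mspace Q" for p p' x
  proof -
    have "K (f p) \<in> mspace ?L" "K (f p') \<in> mspace ?L"
      using K1 fP that by auto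
    from funspace_mdist_le[OF this Q(2), of "mdist ?L (K (f p)) (K (f p'))"]
    have "\<bar>K (f p) x - K (f p') x\<bar> \<le> mdist ?L (K (f p)) (K (f p'))"
      using that by (simp add: dist_real_def)
    also have "\<dots> \<le> B * mdist N p p'"
      using B(2) K2 fP that by simp
    finally show ?thesis .
  qed
  define F where
    "F n = restrict (\<lambda>x. INF p\<in>P. K (f p) x + B * mdist N n p) (mspace Q)" for n
  have low: "K (f p0) x - B * mdist N n p0 \<le> K (f p) x + B * mdist N n p"
    if "p \<in> P" "p0 \<in> P" "n \<in> mspace N" "x \<in> mspace Q" for n p p0 x
  proof -
    have "mdist N p0 p \<le> mdist N n p0 + mdist N n p"
      using mdist_triangle[of p0 N n p] that P by (auto simp: mdist_commute)
    then have "B * mdist N p0 p \<le> B * mdist N n p0 + B * mdist N n p"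
      using B(1) by (simp flip: distrib_left)
    with Kf[of p0 p x] that show ?thesis
      by (auto simp: abs_le_iff)
  qed
  have bdd: "bdd_below ((\<lambda>p. K (f p) x + B * mdist N n p) ` P)"
    if "n \<in> mspace N" "x \<in> mspace Q" for n x
    using low that False by (meson bdd_belowI2 all_not_in_conv)
  have F1: "F n x \<le> K (f p) x + B * mdist N n p"
    if "p \<in> P" "n \<in> mspace N" "x \<in> mspace Q" for p n x
    using that bdd by (auto simp: F_def intro!: cINF_lower)
  have F2: "K (f p) x - B * mdist N n p \<le> F n x"
    if "p \<in> P" "n \<in> mspace N" "x \<in> mspace Q" for p n x
    using that low False by (auto simp: F_def intro!: cINF_greatest)
  have FP: "F p = K (f p)" if "p \<in> P" for p
  proof
    fix x
    show "F p x = K (f p) x"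
    proof (cases "x \<in> mspace Q")
      case True
      then show ?thesis
        using F1[of p p x] F2[of p p x] that P by (auto simp: subset_iff mdist_refl)
    qed (simp add: F_def K_def)
  qed
  have FL: "F n \<in> mspace ?L" if n: "n \<in> mspace N" for n
  proof -
    obtain p where p: "p \<in> P"
      using False by blast
    have "K (f p) \<in> mspace ?L"
      using K1 fP p by auto
    then obtain C where C: "\<And>x. x \<in> mspace Q \<Longrightarrow> \<bar>K (f p) x\<bar> \<le> C"
      by (auto simp: Metric_space.fspace_def[OF Met_TC.Metric_space_axioms] bounded_iff)
    have "\<bar>F n x\<bar> \<le> C + B * mdist N n p" if "x \<in> mspace Q" for x
      using F1[OF p n that] F2[OF p n that] C[OF that] by linarith
    then have "bounded (F n ` mspace Q)"
      by (auto simp: bounded_iff)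
    then show ?thesis
      by (simp add: Metric_space.fspace_def[OF Met_TC.Metric_space_axioms] F_def)
  qed
  have half: "F n x \<le> F n' x + B * mdist N n n'"
    if "n \<in> mspace N" "n' \<in> mspace N" "x \<in> mspace Q" for n n' x
  proof -
    have "F n x - B * mdist N n n' \<le> (INF p\<in>P. K (f p) x + B * mdist N n' p)"
    proof (rule cINF_greatest[OF False])
      fix p assume p: "p \<in> P"
      have "mdist N n p \<le> mdist N n n' + mdist N n' p"
        using mdist_triangle[of n N n' p] that p P by auto
      then have "B * mdist N n p \<le> B * mdist N n n' + B * mdist N n' p"
        using B(1) by (simp flip: distrib_left)
      with F1[OF p that(1,3)]
      show "F n x - B * mdist N n n' \<le> K (f p) x + B * mdist N n' p"
        by linarith
    qed
    with that show ?thesis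
      by (simp add: F_def)
  qed
  have F: "Lipschitz_continuous_map N ?L F"
    unfolding Lipschitz_continuous_map_def
  proof (intro conjI exI[of _ B] ballI)
    fix n n' assume n: "n \<in> mspace N" "n' \<in> mspace N"
    show "mdist ?L (F n) (F n') \<le> B * mdist N n n'"
      unfolding funspace_mdist_le[OF FL[OF n(1)] FL[OF n(2)] Q(2)]
      using half[OF n] half[OF n(2,1)]
      by (auto simp: dist_real_def mdist_commute abs_le_iff algebra_simps)
  qed (use FL in auto)
  define J where "J = inv_into (mspace Q) K"
  have inj: "inj_on K (mspace Q)"
    using K2 by (intro inj_onI) (metis mdist_zero)
  have J: "J (K q) = q" if "q \<in> mspace Q" for q
    using inj that by (simp add: J_def)
  have JL: "Lipschitz_continuous_map (submetric ?L (K ` mspace Q)) Q J"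
    unfolding Lipschitz_continuous_map_def using J K2
    by (auto intro!: exI[of _ 1])
  have "Lipschitz_continuous_map N Q (J \<circ> (r \<circ> F))"
    by (intro Lipschitz_continuous_map_compose[OF _ JL] Lipschitz_continuous_map_compose[OF F r])
  moreover have "(J \<circ> (r \<circ> F)) x = f x" if "x \<in> P" for x
    using that FP rid fP J by simp
  ultimately show ?thesis
    by blast
qed

lemma absolute_lipschitz_retract_retraction:
  fixes Q :: "'a metric" and N :: "'n metric"
  assumes Q: "absolute_lipschitz_retract Q" "mspace Q \<noteq> {}"
    and i: "i \<in> mspace Q \<rightarrow> mspace N"
      "\<And>x y. x \<in> mspace Q \<Longrightarrow> y \<in> mspace Q \<Longrightarrow> mdist N (i x) (i y) = mdist Q x y"
  shows "\<exists>r. Lipschitz_continuous_map N (submetric N (i ` mspace Q)) r \<and>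
             (\<forall>x\<in>i ` mspace Q. r x = x)"
proof -
  define j where "j = inv_into (mspace Q) i"
  have "inj_on i (mspace Q)"
    using i(2) by (intro inj_onI) (metis mdist_zero)
  then have j: "j (i q) = q" if "q \<in> mspace Q" for q
    using that by (simp add: j_def)
  have "Lipschitz_continuous_map (submetric N (i ` mspace Q)) Q j"
    unfolding Lipschitz_continuous_map_def using j i(2)
    by (auto intro!: exI[of _ 1])
  from absolute_lipschitz_retract_extension[OF Q _ this] i(1)
  obtain g where g: "Lipschitz_continuous_map N Q g" "\<forall>x\<in>i ` mspace Q. g x = j x"
    by auto
  have "Lipschitz_continuous_map Q (submetric N (i ` mspace Q)) i"
    unfolding Lipschitz_continuous_map_def using i
    by (auto intro!: exI[of _ 1])
  from Lipschitz_continuous_map_compose[OF g(1) this] show ?thesis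
    using g(2) j by (intro exI[of _ "i \<circ> g"]) auto
qed


section \<open>The Lipschitz space \<open>Lip\<^sub>0(M)\<close>\<close>

text \<open>Pairs with \<open>x = y\<close> contribute \<open>0\<close> to the supremum because \<open>0 / 0 = 0\<close>.\<close>

definition Lip :: "('m::metric_space \<Rightarrow> real) \<Rightarrow> real" where
  "Lip f = (SUP (x, y). \<bar>f x - f y\<bar> / dist x y)"

definition Lip0 :: "'m::metric_space \<Rightarrow> ('m \<Rightarrow> real) set" where
  "Lip0 e = {f. (\<exists>L. L-lipschitz_on UNIV f) \<and> f e = 0}"

text \<open>
  The normed space \<open>Lip\<^sub>0(M)\<close> depends on the base point and hence is a set of functions rather than a
  type; the following is \<^const>\<open>bounded_linear\<close> for maps whose domain is that set with norm
  \<^const>\<open>Lip\<close>.  Values of \<open>T\<close> outside \<open>Lip0 e\<close> are irrelevant.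
\<close>

definition bounded_linear_Lip0 ::
    "'m::metric_space \<Rightarrow> (('m \<Rightarrow> real) \<Rightarrow> 'b::real_normed_vector) \<Rightarrow> bool" where
  "bounded_linear_Lip0 e T \<longleftrightarrow>
     (\<forall>f\<in>Lip0 e. \<forall>g\<in>Lip0 e. T (\<lambda>x. f x + g x) = T f + T g) \<and>
     (\<forall>c. \<forall>f\<in>Lip0 e. T (\<lambda>x. c * f x) = c *\<^sub>R T f) \<and>
     (\<exists>K. \<forall>f\<in>Lip0 e. norm (T f) \<le> Lip f * K)"

end

theory Submission
  imports Defs "HOL-Library.Multiset"
begin

text \<open>
  The sphere of \<open>E\<close> contains a bilipschitz copy of the closed unit ball of \<open>c\<^sub>0\<close>.  Namely, the set
  \<open>c0_face\<close> of unit vectors of \<open>c\<^sub>0\<close> whose first coordinate is \<open>1\<close> is isometric to that ball, and an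
  isomorphic embedding of \<open>c\<^sub>0\<close> into \<open>E\<close> followed by normalization is bilipschitz on it
  (\<open>bilipschitz_on_normalized_c0_face\<close>).  Therefore \<open>M\<close> contains a bilipschitz copy of the ball of
  \<open>c\<^sub>0\<close>, and it suffices to map the Lipschitz functions on such a space onto \<open>\<ell>\<^sub>1 = c\<^sub>0\<^sup>*\<close>
  (\<open>Lip0_onto_ell1_if_c0_face_embeds\<close>).

  The map sends \<open>f\<close> to a linear functional on \<open>c\<^sub>0\<close> that serves as its derivative at the centre of the
  ball.  A Lipschitz function need not have a derivative there, so two averaging devices replace it.
  Blowing \<open>f\<close> up around the centre, with a generalized limit over the scales, gives a Lipschitz
  function \<open>F\<close> defined on arbitrarily large vectors.  An invariant mean over \<open>y\<close> of the increments
  \<open>F (y + z) - F y\<close> is then additive in \<open>z\<close>.  Only finitely supported vectors with natural number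
  entries are needed, and these are the multisets of natural numbers, on which \<open>invariant_mean\<close>
  provides the mean.  The functional obtained is bounded for the sup norm by a multiple of the Lipschitz
  constant of \<open>f\<close>; testing it on indicator vectors shows that its values on the unit vectors form a
  sequence in \<open>\<ell>\<^sub>1\<close> with norm under control (\<open>asymptotic_gradient\<close>).

  The map is onto because a functional given by an element of \<open>\<ell>\<^sub>1\<close> is its own derivative, and because
  its transport to the copy of the ball extends to a Lipschitz function on \<open>M\<close>
  (\<open>lipschitz_extension_real\<close>).
\<close>

section \<open>Generalized limits of bounded sequences\<close>

text \<open>
  Evaluation at \<open>n\<close> is a point of the product of the compact intervals in which the values of the
  bounded sequences lie.  By Tychonoff these points have a cluster point \<open>l\<close>.  Hence some proper filter
  finer than \<open>sequentially\<close> makes every bounded sequence \<open>u\<close> converge to \<open>l u\<close>, and \<open>l\<close> inherits the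
  rules for limits.
\<close>

lemma generalized_limit:
  obtains L :: "(nat \<Rightarrow> real) \<Rightarrow> real" where
    "\<And>u v. Bseq u \<Longrightarrow> Bseq v \<Longrightarrow> L (\<lambda>n. u n + v n) = L u + L v"
    "\<And>c u. Bseq u \<Longrightarrow> L (\<lambda>n. c * u n) = c * L u"
    "\<And>u l. u \<longlonglongrightarrow> l \<Longrightarrow> L u = l"
    "\<And>u C. (\<And>n. \<bar>u n\<bar> \<le> C) \<Longrightarrow> \<bar>L u\<bar> \<le> C"
proof -
  define bd where "bd u = (SOME b. 0 \<le> b \<and> (Bseq u \<longrightarrow> (\<forall>n. \<bar>u n\<bar> \<le> b)))" for u :: "nat \<Rightarrow> real"
  have bd: "0 \<le> bd u \<and> (Bseq u \<longrightarrow> (\<forall>n. \<bar>u n\<bar> \<le> bd u))" for u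
  proof -
    have "\<exists>b. 0 \<le> b \<and> (Bseq u \<longrightarrow> (\<forall>n. \<bar>u n\<bar> \<le> b))"
    proof (cases "Bseq u")
      case True
      then obtain K where "K > 0" "\<forall>n. norm (u n) \<le> K"
        by (auto simp: Bseq_def)
      then show ?thesis
        by (intro exI[of _ K]) auto
    qed auto
    then show ?thesis
      unfolding bd_def by (rule someI_ex)
  qed
  \<comment> \<open>unbounded sequences get the value \<open>0\<close>, so that the product may run over all sequences\<close>
  define ev where "ev n = (\<lambda>u :: nat \<Rightarrow> real. if Bseq u then u n else 0)" for n
  let ?K = "\<Pi>\<^sub>E u\<in>UNIV. {- bd u..bd u}"
  have "compactin (product_topology (\<lambda>_. euclidean) UNIV) ?K"
    by (simp add: compactin_PiE)
  then have "compact ?K"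
    by (simp add: euclidean_product_topology)
  moreover have "ev n \<in> ?K" for n
  proof -
    have "\<bar>ev n u\<bar> \<le> bd u" for u
      using bd[of u] by (simp add: ev_def)
    then show ?thesis
      by (auto simp: abs_le_iff minus_le_iff)
  qed
  then have "\<forall>\<^sub>F x in filtermap ev sequentially. x \<in> ?K"
    by (simp add: eventually_filtermap)
  moreover have "filtermap ev sequentially \<noteq> bot"
    by (simp add: filtermap_bot_iff)
  ultimately obtain l where l: "inf (nhds l) (filtermap ev sequentially) \<noteq> bot"
    unfolding compact_filter by blast
  define G where "G = inf (filtercomap ev (nhds l)) sequentially"
  \<comment> \<open>pulling the clustering back along \<open>ev\<close> keeps the filter proper\<close>
  have G: "G \<noteq> bot"
  proof
    assume "G = bot"
    then have "eventually (\<lambda>_. False) G"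
      by simp
    then obtain P Q where P: "eventually P (filtercomap ev (nhds l))"
      and Q: "eventually Q sequentially" and PQ: "\<And>n. P n \<Longrightarrow> Q n \<Longrightarrow> False"
      unfolding G_def eventually_inf by auto
    from P obtain R where R: "eventually R (nhds l)" "\<And>n. R (ev n) \<Longrightarrow> P n"
      by (auto simp: eventually_filtercomap)
    have "eventually (\<lambda>x. \<not> R x) (filtermap ev sequentially)"
      unfolding eventually_filtermap using Q by eventually_elim (use R PQ in blast)
    with R(1) have "eventually (\<lambda>_. False) (inf (nhds l) (filtermap ev sequentially))"
      unfolding eventually_inf by blast
    with l show False
      by (simp add: trivial_limit_def)
  qed
  have lim: "(u \<longlongrightarrow> l u) G" if "Bseq u" for u
  proof -
    have "filterlim ev (nhds l) G"
      unfolding G_def filterlim_iff_le_filtercomap by simp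
    moreover have "continuous_on UNIV (\<lambda>x :: (nat \<Rightarrow> real) \<Rightarrow> real. x u)"
      by (rule continuous_on_product_coordinates)
    then have "((\<lambda>x. x u) \<longlongrightarrow> l u) (at l)"
      by (simp add: continuous_on_def)
    ultimately have "((\<lambda>n. ev n u) \<longlongrightarrow> l u) G"
      by (rule tendsto_compose[rotated])
    with that show ?thesis
      by (simp add: ev_def)
  qed
  show thesis
  proof (rule that[of l])
    fix u v :: "nat \<Rightarrow> real" assume uv: "Bseq u" "Bseq v"
    then have "Bseq (\<lambda>n. u n + v n)"
      unfolding Bseq_eq_bounded by (rule bounded_plus_comp)
    from lim[OF this] show "l (\<lambda>n. u n + v n) = l u + l v"
      using tendsto_add[OF lim[OF uv(1)] lim[OF uv(2)]] tendsto_unique[OF G] by blast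
  next
    fix c :: real and u :: "nat \<Rightarrow> real" assume u: "Bseq u"
    then have "Bseq (\<lambda>n. c * u n)"
      by (intro Bseq_mult) auto
    from lim[OF this] show "l (\<lambda>n. c * u n) = c * l u"
      using tendsto_mult_left[OF lim[OF u]] tendsto_unique[OF G] by blast
  next
    fix u :: "nat \<Rightarrow> real" and a assume u: "u \<longlonglongrightarrow> a"
    then have "(u \<longlongrightarrow> a) G"
      by (rule tendsto_mono[rotated]) (simp add: G_def)
    moreover have "Bseq u"
      using u convergentI convergent_imp_Bseq by blast
    ultimately show "l u = a"
      using lim tendsto_unique[OF G] by blast
  next
    fix u :: "nat \<Rightarrow> real" and C assume C: "\<And>n. \<bar>u n\<bar> \<le> C"
    then have "Bseq u"
      by (intro BseqI'[of _ C]) simp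
    then have "((\<lambda>n. \<bar>u n\<bar>) \<longlongrightarrow> \<bar>l u\<bar>) G"
      by (intro tendsto_rabs lim)
    then show "\<bar>l u\<bar> \<le> C"
      by (rule tendsto_upperbound) (use C G in auto)
  qed
qed

section \<open>An invariant mean on finitely supported vectors of natural numbers\<close>

text \<open>
  A multiset over \<open>'a\<close> is a finitely supported function from \<open>'a\<close> to the natural numbers, and adding an
  element \<open>i\<close> is a step in the direction of the \<open>i\<close>-th coordinate.
\<close>

definition shift_average :: "nat \<Rightarrow> 'a \<Rightarrow> ('a multiset \<Rightarrow> real) \<Rightarrow> 'a multiset \<Rightarrow> real" where
  "shift_average N i h y = (\<Sum>j<N. h (y + replicate_mset j i)) / N"

primrec box_average :: "nat \<Rightarrow> nat \<Rightarrow> (nat multiset \<Rightarrow> real) \<Rightarrow> nat multiset \<Rightarrow> real" where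
  "box_average N 0 h = h"
| "box_average N (Suc k) h = box_average N k (shift_average N k h)"

lemma shift_average_bound:
  assumes "\<And>y. \<bar>h y\<bar> \<le> C" "N > 0"
  shows "\<bar>shift_average N i h y\<bar> \<le> C"
proof -
  have "\<bar>\<Sum>j<N. h (y + replicate_mset j i)\<bar> \<le> (\<Sum>j<N. C)"
    by (rule order_trans[OF sum_abs]) (intro sum_mono assms)
  with assms(2) show ?thesis
    by (simp add: shift_average_def field_simps)
qed

lemma box_average_bound:
  assumes "\<And>y. \<bar>h y\<bar> \<le> C" "N > 0"
  shows "\<bar>box_average N k h y\<bar> \<le> C"
  using assms(1)
proof (induction k arbitrary: h)
  case (Suc k)
  have "\<bar>shift_average N k h y\<bar> \<le> C" for y
    using shift_average_bound[OF Suc.prems assms(2)] .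
  from Suc.IH[OF this] show ?case
    by simp
qed simp

lemma box_average_add:
  "box_average N k (\<lambda>y. g y + h y) y = box_average N k g y + box_average N k h y"
proof (induction k arbitrary: g h)
  case (Suc k)
  have "shift_average N k (\<lambda>y. g y + h y) = (\<lambda>y. shift_average N k g y + shift_average N k h y)"
    by (simp add: fun_eq_iff shift_average_def sum.distrib add_divide_distrib)
  with Suc show ?case
    by simp
qed simp

lemma box_average_cmult:
  "box_average N k (\<lambda>y. c * h y) y = c * box_average N k h y"
proof (induction k arbitrary: h)
  case (Suc k)
  have "shift_average N k (\<lambda>y. c * h y) = (\<lambda>y. c * shift_average N k h y)"
    by (simp add: fun_eq_iff shift_average_def sum_distrib_left)
  with Suc show ?case
    by simp
qed simp

lemma box_average_const:
  "N > 0 \<Longrightarrow> box_average N k (\<lambda>_. c) y = c"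
proof (induction k)
  case (Suc k)
  have "shift_average N k (\<lambda>_. c) = (\<lambda>_. c)"
    using Suc.prems by (simp add: fun_eq_iff shift_average_def)
  with Suc show ?case
    by simp
qed simp

text \<open>
  In the average over direction \<open>n\<close> the differences telescope, leaving two boundary terms divided by
  \<open>N\<close>; the averages over the other directions commute with the step and do not increase the bound.
\<close>

lemma box_average_shift_difference:
  assumes "\<And>y. \<bar>h y\<bar> \<le> C" "N > 0" "n < k"
  shows "\<bar>box_average N k (\<lambda>y. h (add_mset n y) - h y) y\<bar> \<le> 2 * C / N"
  using assms(1,3)
proof (induction k arbitrary: h)
  case (Suc k)
  show ?case
  proof (cases "n = k")
    case True
    have "\<bar>shift_average N k (\<lambda>y. h (add_mset n y) - h y) y\<bar> \<le> 2 * C / N" for y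
    proof -
      have "(\<Sum>j<N. h (add_mset k (y + replicate_mset j k)) - h (y + replicate_mset j k))
          = h (y + replicate_mset N k) - h y"
        using sum_lessThan_telescope[of "\<lambda>j. h (y + replicate_mset j k)" N] by simp
      moreover have "\<bar>h (y + replicate_mset N k) - h y\<bar> \<le> 2 * C"
        using Suc.prems(1)[of "y + replicate_mset N k"] Suc.prems(1)[of y] by linarith
      ultimately show ?thesis
        using True by (simp add: shift_average_def divide_right_mono)
    qed
    from box_average_bound[OF this assms(2)] show ?thesis
      by simp
  next
    case False
    have "shift_average N k (\<lambda>y. h (add_mset n y) - h y)
        = (\<lambda>y. shift_average N k h (add_mset n y) - shift_average N k h y)"
      by (simp add: fun_eq_iff shift_average_def sum_subtractf diff_divide_distrib)
    moreover have "\<bar>shift_average N k h y\<bar> \<le> C" for y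
      using shift_average_bound[OF Suc.prems(1) assms(2)] .
    ultimately show ?thesis
      using Suc.IH[of "shift_average N k h"] Suc.prems(2) False by simp
  qed
qed simp

text \<open>
  The averages over cubes with \<open>k\<close> directions and side \<open>k + 1\<close> become invariant under each fixed unit
  step as \<open>k\<close> grows, since the boundary terms are of order \<open>1 / k\<close>; a generalized limit makes the
  invariance exact.
\<close>

lemma invariant_mean:
  obtains \<Lambda> :: "(nat multiset \<Rightarrow> real) \<Rightarrow> real" where
    "\<And>g h. bounded (range g) \<Longrightarrow> bounded (range h) \<Longrightarrow> \<Lambda> (\<lambda>y. g y + h y) = \<Lambda> g + \<Lambda> h"
    "\<And>c h. bounded (range h) \<Longrightarrow> \<Lambda> (\<lambda>y. c * h y) = c * \<Lambda> h"
    "\<And>c. \<Lambda> (\<lambda>_. c) = c"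
    "\<And>h C. (\<And>y. \<bar>h y\<bar> \<le> C) \<Longrightarrow> \<bar>\<Lambda> h\<bar> \<le> C"
    "\<And>h z. bounded (range h) \<Longrightarrow> \<Lambda> (\<lambda>y. h (y + z)) = \<Lambda> h"
proof -
  obtain L :: "(nat \<Rightarrow> real) \<Rightarrow> real" where L:
    "\<And>u v. Bseq u \<Longrightarrow> Bseq v \<Longrightarrow> L (\<lambda>n. u n + v n) = L u + L v"
    "\<And>c u. Bseq u \<Longrightarrow> L (\<lambda>n. c * u n) = c * L u"
    "\<And>u l. u \<longlonglongrightarrow> l \<Longrightarrow> L u = l"
    "\<And>u C. (\<And>n. \<bar>u n\<bar> \<le> C) \<Longrightarrow> \<bar>L u\<bar> \<le> C"
    using generalized_limit by blast
  define m where "m h k = box_average (Suc k) k h {#}" for h k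
  define \<Lambda> where "\<Lambda> h = L (m h)" for h
  have m_bound: "\<bar>m h k\<bar> \<le> C" if "\<And>y. \<bar>h y\<bar> \<le> C" for h C k
    unfolding m_def by (rule box_average_bound) (use that in auto)
  have m_Bseq: "Bseq (m h)" if h: "bounded (range h)" for h
  proof -
    obtain C where "\<And>y. \<bar>h y\<bar> \<le> C"
      using h by (auto simp: bounded_iff)
    from m_bound[of h, OF this] show ?thesis
      by (intro BseqI'[of _ C]) simp
  qed
  have add: "\<Lambda> (\<lambda>y. g y + h y) = \<Lambda> g + \<Lambda> h" if "bounded (range g)" "bounded (range h)" for g h
    using L(1)[OF that[THEN m_Bseq]] by (simp add: \<Lambda>_def m_def[abs_def] box_average_add)
  have cmult: "\<Lambda> (\<lambda>y. c * h y) = c * \<Lambda> h" if "bounded (range h)" for c h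
    using L(2)[OF that[THEN m_Bseq]] by (simp add: \<Lambda>_def m_def[abs_def] box_average_cmult)
  have shift1: "\<Lambda> (\<lambda>y. h (add_mset n y)) = \<Lambda> h" if h: "bounded (range h)" for h n
  proof -
    obtain C where C: "\<And>y. \<bar>h y\<bar> \<le> C"
      using h by (auto simp: bounded_iff)
    let ?d = "\<lambda>y. h (add_mset n y) - h y"
    have "\<bar>?d y\<bar> \<le> 2 * C" for y
      using C[of y] C[of "add_mset n y"] by linarith
    then have d: "bounded (range ?d)"
      unfolding bounded_iff real_norm_def by blast
    have "m ?d \<longlonglongrightarrow> 0"
    proof (rule Lim_null_comparison)
      show "\<forall>\<^sub>F k in sequentially. norm (m ?d k) \<le> 2 * C / real (Suc k)"
        using eventually_gt_at_top[of n]
        by eventually_elim (unfold m_def real_norm_def, rule box_average_shift_difference[OF C], auto)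
      show "(\<lambda>k. 2 * C / real (Suc k)) \<longlonglongrightarrow> 0"
        by (intro LIMSEQ_Suc lim_const_over_n)
    qed
    then have "\<Lambda> ?d = 0"
      unfolding \<Lambda>_def by (rule L(3))
    with add[OF d h] show ?thesis
      by simp
  qed
  show thesis
  proof (rule that[of \<Lambda>])
    show "\<Lambda> (\<lambda>_. c) = c" for c
      by (simp add: \<Lambda>_def m_def[abs_def] box_average_const L(3))
    show "\<bar>\<Lambda> h\<bar> \<le> C" if "\<And>y. \<bar>h y\<bar> \<le> C" for h C
      unfolding \<Lambda>_def by (rule L(4)) (rule m_bound[OF that])
    show "\<Lambda> (\<lambda>y. h (y + z)) = \<Lambda> h" if "bounded (range h)" for h z
    proof (induction z)
      case (add n z)
      have "bounded (range (\<lambda>y. h (y + z)))"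
        by (rule bounded_subset[OF that]) auto
      from shift1[OF this, of n] add show ?case
        by simp
    qed simp
  qed (fact add cmult)+
qed

section \<open>Averaged partial derivatives at infinitesimal scale\<close>

text \<open>
  Think of \<open>p k y\<close> as the image in the metric space of the point \<open>y / k\<close> of a ball of \<open>c\<^sub>0\<close>, the
  multiset \<open>y\<close> standing for the vector of its multiplicities.  The rescaled functions
  \<open>y \<mapsto> k (f (p k y) - f (p k 0))\<close> are Lipschitz in the sup norm uniformly in \<open>k\<close>, so a generalized
  limit turns them into one Lipschitz function \<open>F\<close> on the whole unbounded orthant.  There an invariant
  mean exists without boundary effects, and averaging \<open>F (y + z) - F y\<close> over \<open>y\<close> yields something
  additive in \<open>z\<close>.  Its value at the \<open>n\<close>-th unit vector is \<open>\<phi> f n\<close>.  Additivity is what bounds sums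
  over arbitrary finite sets \<open>A\<close> independently of the size of \<open>A\<close>: such a sum is the averaged increment
  along the indicator of \<open>A\<close>, a vector of sup norm at most \<open>1\<close>.  If \<open>f\<close> is affine along \<open>p\<close>, nothing
  is lost in the limits.
\<close>

lemma asymptotic_gradient:
  fixes p :: "nat \<Rightarrow> nat multiset \<Rightarrow> 'm::metric_space"
  assumes p: "\<And>k y z d. (\<And>i. count z i \<le> d) \<Longrightarrow> real k * dist (p k (y + z)) (p k y) \<le> C * real d"
  obtains \<phi> :: "('m \<Rightarrow> real) \<Rightarrow> nat \<Rightarrow> real" where
    "\<And>K L f g n. K-lipschitz_on UNIV f \<Longrightarrow> L-lipschitz_on UNIV g \<Longrightarrow>
       \<phi> (\<lambda>x. f x + g x) n = \<phi> f n + \<phi> g n"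
    "\<And>L c f n. L-lipschitz_on UNIV f \<Longrightarrow> \<phi> (\<lambda>x. c * f x) n = c * \<phi> f n"
    "\<And>L f A. L-lipschitz_on UNIV f \<Longrightarrow> finite A \<Longrightarrow> \<bar>\<Sum>n\<in>A. \<phi> f n\<bar> \<le> C * L"
    "\<And>f a b n. (\<And>y. \<forall>\<^sub>F k in sequentially. f (p k y) = b + (\<Sum>i\<in>#y. a i) / k) \<Longrightarrow>
       \<phi> f n = a n"
proof -
  obtain lim :: "(nat \<Rightarrow> real) \<Rightarrow> real" where lim:
    "\<And>u v. Bseq u \<Longrightarrow> Bseq v \<Longrightarrow> lim (\<lambda>n. u n + v n) = lim u + lim v"
    "\<And>c u. Bseq u \<Longrightarrow> lim (\<lambda>n. c * u n) = c * lim u"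
    "\<And>u l. u \<longlonglongrightarrow> l \<Longrightarrow> lim u = l"
    "\<And>u C. (\<And>n. \<bar>u n\<bar> \<le> C) \<Longrightarrow> \<bar>lim u\<bar> \<le> C"
    using generalized_limit by blast
  obtain \<Lambda> :: "(nat multiset \<Rightarrow> real) \<Rightarrow> real" where \<Lambda>:
    "\<And>g h. bounded (range g) \<Longrightarrow> bounded (range h) \<Longrightarrow> \<Lambda> (\<lambda>y. g y + h y) = \<Lambda> g + \<Lambda> h"
    "\<And>c h. bounded (range h) \<Longrightarrow> \<Lambda> (\<lambda>y. c * h y) = c * \<Lambda> h"
    "\<And>c. \<Lambda> (\<lambda>_. c) = c"
    "\<And>h C. (\<And>y. \<bar>h y\<bar> \<le> C) \<Longrightarrow> \<bar>\<Lambda> h\<bar> \<le> C"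
    "\<And>h z. bounded (range h) \<Longrightarrow> \<Lambda> (\<lambda>y. h (y + z)) = \<Lambda> h"
    using invariant_mean by blast
  define q where "q f y k = real k * (f (p k y) - f (p k {#}))" for f :: "'m \<Rightarrow> real" and y k
  define F where "F f y = lim (q f y)" for f y
  define \<Phi> where "\<Phi> f z = \<Lambda> (\<lambda>y. F f (y + z) - F f y)" for f z

  have q_diff: "\<bar>q f (y + z) k - q f y k\<bar> \<le> C * L * d"
    if f: "L-lipschitz_on UNIV f" and z: "\<And>i. count z i \<le> d" for L f y z d k
  proof -
    have L: "0 \<le> L"
      using lipschitz_on_nonneg[OF f] .
    have "\<bar>q f (y + z) k - q f y k\<bar> = real k * dist (f (p k (y + z))) (f (p k y))"
      by (simp add: q_def dist_real_def abs_mult flip: right_diff_distrib)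
    also have "\<dots> \<le> real k * (L * dist (p k (y + z)) (p k y))"
      by (intro mult_left_mono lipschitz_onD[OF f]) auto
    also have "\<dots> = L * (real k * dist (p k (y + z)) (p k y))"
      by simp
    also have "\<dots> \<le> L * (C * d)"
      by (intro mult_left_mono p z L)
    finally show ?thesis
      by (simp add: mult_ac)
  qed
  have q_Bseq: "Bseq (q f y)" if f: "L-lipschitz_on UNIV f" for L f y
  proof (rule BseqI')
    fix k
    have "\<bar>q f ({#} + y) k - q f {#} k\<bar> \<le> C * L * size y"
      by (rule q_diff[OF f count_le_size])
    then show "norm (q f y k) \<le> C * L * size y"
      by (simp add: q_def)
  qed
  have F_diff: "\<bar>F f (y + z) - F f y\<bar> \<le> C * L * d"
    if f: "L-lipschitz_on UNIV f" and z: "\<And>i. count z i \<le> d" for L f y z d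
  proof -
    have B: "Bseq (\<lambda>k. q f (y + z) k - q f y k)"
      by (rule BseqI') (use q_diff[OF that] in simp)
    have "lim (\<lambda>k. q f (y + z) k - q f y k) = F f (y + z) - F f y"
      using lim(1)[OF B q_Bseq[OF f, of y]] by (simp add: F_def)
    moreover have "\<bar>lim (\<lambda>k. q f (y + z) k - q f y k)\<bar> \<le> C * L * d"
      by (rule lim(4)) (rule q_diff[OF that])
    ultimately show ?thesis
      by simp
  qed
  have D_bounded: "bounded (range (\<lambda>y. F f (y + z) - F f y))" if f: "L-lipschitz_on UNIV f" for L f z
    unfolding bounded_iff using F_diff[OF f count_le_size[of z]]
    by (intro exI[of _ "C * L * size z"]) simp
  \<comment> \<open>the increment along \<open>z + w\<close> splits into one along \<open>z\<close> and a translate of the one along \<open>w\<close>\<close>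
  have \<Phi>_add: "\<Phi> f (z + w) = \<Phi> f z + \<Phi> f w" if f: "L-lipschitz_on UNIV f" for L f z w
  proof -
    let ?D = "\<lambda>y. F f (y + w) - F f y"
    have "\<Phi> f (z + w) = \<Lambda> (\<lambda>y. (F f (y + z) - F f y) + ?D (y + z))"
      unfolding \<Phi>_def by (simp add: add.assoc)
    also have "\<dots> = \<Phi> f z + \<Lambda> (\<lambda>y. ?D (y + z))"
      unfolding \<Phi>_def by (intro \<Lambda>(1) D_bounded[OF f] bounded_subset[OF D_bounded[OF f, of w]]) auto
    also have "\<Lambda> (\<lambda>y. ?D (y + z)) = \<Phi> f w"
      unfolding \<Phi>_def by (rule \<Lambda>(5)[OF D_bounded[OF f]])
    finally show ?thesis .
  qed
  have \<Phi>_sum: "\<Phi> f (mset_set A) = (\<Sum>n\<in>A. \<Phi> f {#n#})"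
    if f: "L-lipschitz_on UNIV f" and "finite A" for L f A
    using \<open>finite A\<close>
  proof induction
    case empty
    show ?case
      by (simp add: \<Phi>_def \<Lambda>(3))
  next
    case (insert n A)
    then show ?case
      using \<Phi>_add[OF f, of "{#n#}" "mset_set A"] by simp
  qed
  show thesis
  proof (rule that[of "\<lambda>f n. \<Phi> f {#n#}"])
    fix K L :: real and f g :: "'m \<Rightarrow> real" and n
    assume f: "K-lipschitz_on UNIV f" and g: "L-lipschitz_on UNIV g"
    have "F (\<lambda>x. f x + g x) y = F f y + F g y" for y
      using lim(1)[OF q_Bseq[OF f, of y] q_Bseq[OF g, of y]]
      by (simp add: F_def q_def[abs_def] algebra_simps)
    then show "\<Phi> (\<lambda>x. f x + g x) {#n#} = \<Phi> f {#n#} + \<Phi> g {#n#}"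
      using \<Lambda>(1)[OF D_bounded[OF f, of "{#n#}"] D_bounded[OF g, of "{#n#}"]]
      by (simp add: \<Phi>_def algebra_simps)
  next
    fix L c :: real and f :: "'m \<Rightarrow> real" and n
    assume f: "L-lipschitz_on UNIV f"
    have "F (\<lambda>x. c * f x) y = c * F f y" for y
      using lim(2)[OF q_Bseq[OF f, of y], of c]
      by (simp add: F_def q_def[abs_def] algebra_simps)
    then show "\<Phi> (\<lambda>x. c * f x) {#n#} = c * \<Phi> f {#n#}"
      using \<Lambda>(2)[OF D_bounded[OF f, of "{#n#}"], of c]
      by (simp add: \<Phi>_def right_diff_distrib)
  next
    fix L :: real and f :: "'m \<Rightarrow> real" and A :: "nat set"
    assume f: "L-lipschitz_on UNIV f" and A: "finite A"
    have "\<bar>F f (y + mset_set A) - F f y\<bar> \<le> C * L * (1 :: nat)" for y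
      by (rule F_diff[OF f]) (simp add: count_mset_set')
    then have "\<bar>\<Phi> f (mset_set A)\<bar> \<le> C * L"
      unfolding \<Phi>_def by (intro \<Lambda>(4)) simp
    with \<Phi>_sum[OF f A] show "\<bar>\<Sum>n\<in>A. \<Phi> f {#n#}\<bar> \<le> C * L"
      by simp
  next
    fix b :: real and f :: "'m \<Rightarrow> real" and a :: "nat \<Rightarrow> real" and n
    assume f: "\<And>y. \<forall>\<^sub>F k in sequentially. f (p k y) = b + (\<Sum>i\<in>#y. a i) / k"
    have "F f y = (\<Sum>i\<in>#y. a i)" for y
    proof -
      have "\<forall>\<^sub>F k in sequentially. q f y k = (\<Sum>i\<in>#y. a i)"
        using f[of y] f[of "{#}"] eventually_gt_at_top[of 0]
        by eventually_elim (simp add: q_def)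
      then show ?thesis
        unfolding F_def by (intro lim(3) tendsto_eventually)
    qed
    then show "\<Phi> f {#n#} = a n"
      by (simp add: \<Phi>_def \<Lambda>(3))
  qed
qed

section \<open>Extension of real-valued Lipschitz functions\<close>

text \<open>
  The McShane extension: the infimum of the cones \<open>x \<mapsto> u p + C d(x, p)\<close> is \<open>C\<close>-Lipschitz because each
  cone is, and the Lipschitz condition on \<open>u\<close> says that at a point of \<open>P\<close> the cone with that apex is
  the lowest.
\<close>

lemma lipschitz_extension_real:
  fixes u :: "'m::metric_space \<Rightarrow> real"
  assumes u: "C-lipschitz_on P u"
  obtains g where "C-lipschitz_on UNIV g" "\<And>x. x \<in> P \<Longrightarrow> g x = u x"
proof (cases "P = {}")
  case True
  with lipschitz_on_nonneg[OF u] show ?thesis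
    by (intro that[of "\<lambda>_. 0"]) (auto intro: lipschitz_onI)
next
  case False
  have C: "0 \<le> C"
    using lipschitz_on_nonneg[OF u] .
  define g where "g x = (INF p\<in>P. u p + C * dist x p)" for x
  have low: "u q - C * dist x q \<le> u p + C * dist x p" if "p \<in> P" "q \<in> P" for p q x
  proof -
    have "u q - u p \<le> C * dist q p"
      using lipschitz_onD[OF u that(2,1)] by (simp add: dist_real_def)
    also have "\<dots> \<le> C * (dist x q + dist x p)"
      by (intro mult_left_mono C dist_triangle3)
    finally show ?thesis
      by (simp add: algebra_simps)
  qed
  have bdd: "bdd_below ((\<lambda>p. u p + C * dist x p) ` P)" for x
    using low False by (meson bdd_belowI2 all_not_in_conv)
  have half: "g x \<le> g y + C * dist x y" for x y
  proof -
    have "g x - C * dist x y \<le> g y"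
      unfolding g_def[of y]
    proof (rule cINF_greatest[OF False])
      fix p assume p: "p \<in> P"
      have "g x \<le> u p + C * dist x p"
        unfolding g_def by (rule cINF_lower[OF bdd p])
      moreover have "C * dist x p \<le> C * (dist x y + dist y p)"
        by (intro mult_left_mono C dist_triangle)
      ultimately show "g x - C * dist x y \<le> u p + C * dist y p"
        by (simp add: algebra_simps)
    qed
    then show ?thesis
      by simp
  qed
  show ?thesis
  proof (rule that[of g])
    show "C-lipschitz_on UNIV g"
    proof (rule lipschitz_onI[OF _ C])
      show "dist (g x) (g y) \<le> C * dist x y" for x y
        using half[of x y] half[of y x] by (simp add: dist_real_def abs_le_iff dist_commute)
    qed
    fix x assume x: "x \<in> P"
    have "g x \<le> u x"
      using cINF_lower[OF bdd x, of x] by (simp add: g_def)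
    moreover have "u x \<le> g x"
      unfolding g_def using low[OF _ x, of _ x] by (intro cINF_greatest[OF False]) simp
    ultimately show "g x = u x"
      by simp
  qed
qed

section \<open>A face of the unit ball of \<open>c\<^sub>0\<close> inside the sphere of \<open>E\<close>\<close>

lemma c0_nth_le_norm: "\<bar>c0_nth x n\<bar> \<le> norm x"
  unfolding norm_c0_def by (rule cSUP_upper[OF _ bdd_above_c0]) simp

lemma norm_c0_leI: "(\<And>n. \<bar>c0_nth x n\<bar> \<le> C) \<Longrightarrow> norm x \<le> C"
  unfolding norm_c0_def by (rule cSUP_least) auto

text \<open>
  Deleting the coordinate with index \<open>0\<close> identifies this set isometrically with the closed unit ball
  of \<open>c\<^sub>0\<close>.
\<close>

definition c0_face :: "c0 set" where
  "c0_face = {z. c0_nth z 0 = 1 \<and> norm z = 1}"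

lemma bounded_linear_homeomorphism_bounded_below:
  fixes T :: "'a::real_normed_vector \<Rightarrow> 'b::real_normed_vector"
  assumes T: "bounded_linear T" and S: "homeomorphism UNIV (range T) T S"
  obtains c where "c > 0" "\<And>x. c * norm x \<le> norm (T x)"
proof -
  interpret T: bounded_linear T by fact
  have "continuous_on (range T) S" and S: "\<And>x. S (T x) = x"
    using S by (auto simp: homeomorphism_def)
  moreover have "S 0 = 0"
    using S[of 0] by (simp add: T.zero)
  moreover have "0 \<in> range T"
    using T.zero by (metis rangeI)
  ultimately obtain c where c: "c > 0" "\<And>v. v \<in> range T \<Longrightarrow> norm v < c \<Longrightarrow> norm (S v) < 1"
    unfolding continuous_on_iff by (metis dist_0_norm dist_commute zero_less_one)
  have "c * norm x \<le> norm (T x)" for x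
  proof (rule ccontr)
    assume *: "\<not> c * norm x \<le> norm (T x)"
    then have "x \<noteq> 0"
      by auto
    let ?x = "(1 / norm x) *\<^sub>R x"
    have "norm (T ?x) < c"
      using * \<open>x \<noteq> 0\<close> by (simp add: T.scaleR field_simps)
    from c(2)[OF _ this] have "norm ?x < 1"
      by (simp add: S)
    with \<open>x \<noteq> 0\<close> show False
      by simp
  qed
  with c(1) show thesis
    by (rule that)
qed

text \<open>
  Normalizing could bring close together points on nearly the same ray.  On the face this cannot
  happen: coordinate \<open>0\<close> of \<open>s *\<^sub>R z - t *\<^sub>R w\<close> is \<open>s - t\<close>, so a small difference of rescaled points
  forces the scaling factors, and then the points themselves, to be close.
\<close>

lemma bilipschitz_on_normalized_c0_face:
  fixes T :: "c0 \<Rightarrow> 'e::real_normed_vector"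
  assumes T: "bounded_linear T" and c: "c > 0" "\<And>x. c * norm x \<le> norm (T x)"
  shows "bilipschitz_on c0_face (\<lambda>z. T z /\<^sub>R norm (T z))"
proof -
  interpret T: bounded_linear T by fact
  obtain K where K: "K > 0" "\<And>x. norm (T x) \<le> norm x * K"
    using T.pos_bounded by blast
  have "c / (2 * K) * dist z w \<le> dist (T z /\<^sub>R norm (T z)) (T w /\<^sub>R norm (T w)) \<and>
        dist (T z /\<^sub>R norm (T z)) (T w /\<^sub>R norm (T w)) \<le> 2 * K / c * dist z w"
    if zw: "z \<in> c0_face" "w \<in> c0_face" for z w
  proof
    define s t where "s = inverse (norm (T z))" and "t = inverse (norm (T w))"
    have Tz: "c \<le> norm (T z)" "norm (T z) \<le> K" and Tw: "c \<le> norm (T w)" "norm (T w) \<le> K"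
      using c(2)[of z] c(2)[of w] K(2)[of z] K(2)[of w] zw by (auto simp: c0_face_def)
    have pos: "0 < norm (T z)" "0 < norm (T w)"
      using Tz(1) Tw(1) c(1) by linarith+
    from pos(1) have s: "inverse K \<le> s" "s \<le> inverse c" "0 < s"
      unfolding s_def
      using le_imp_inverse_le[OF Tz(2)] le_imp_inverse_le[OF Tz(1) c(1)] by simp_all
    have t: "t * norm (T w) = 1"
      unfolding t_def by (rule left_inverse) (use pos in linarith)
    have eq: "T z /\<^sub>R norm (T z) - T w /\<^sub>R norm (T w) = T (s *\<^sub>R z - t *\<^sub>R w)"
      by (simp add: s_def t_def T.diff T.scaleR)
    have "\<bar>s - t\<bar> \<le> norm (s *\<^sub>R z - t *\<^sub>R w)"
      using c0_nth_le_norm[of "s *\<^sub>R z - t *\<^sub>R w" 0] zw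
      by (simp add: minus_c0.rep_eq scaleR_c0.rep_eq c0_face_def)
    moreover have "s * norm (z - w) \<le> norm (s *\<^sub>R z - t *\<^sub>R w) + \<bar>s - t\<bar>"
    proof -
      have "s *\<^sub>R (z - w) = (s *\<^sub>R z - t *\<^sub>R w) - (s - t) *\<^sub>R w"
        by (simp add: algebra_simps)
      then have "norm (s *\<^sub>R (z - w)) \<le> norm (s *\<^sub>R z - t *\<^sub>R w) + norm ((s - t) *\<^sub>R w)"
        by (metis norm_triangle_ineq4)
      with s(3) zw show ?thesis
        by (simp add: c0_face_def)
    qed
    ultimately have "s * norm (z - w) \<le> 2 * norm (s *\<^sub>R z - t *\<^sub>R w)"
      by linarith
    moreover have "inverse K * norm (z - w) \<le> s * norm (z - w)"
      by (intro mult_right_mono s) auto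
    ultimately have "c * (inverse K * norm (z - w)) \<le> c * (2 * norm (s *\<^sub>R z - t *\<^sub>R w))"
      using c(1) by (intro mult_left_mono) auto
    also have "\<dots> \<le> 2 * norm (T (s *\<^sub>R z - t *\<^sub>R w))"
      using c(2)[of "s *\<^sub>R z - t *\<^sub>R w"] by simp
    finally show "c / (2 * K) * dist z w \<le> dist (T z /\<^sub>R norm (T z)) (T w /\<^sub>R norm (T w))"
      unfolding dist_norm eq using K(1) by (simp add: field_simps)
    have "\<bar>s - t\<bar> * norm (T w) = s * \<bar>norm (T w) - norm (T z)\<bar>"
    proof -
      have "s * norm (T z) = 1"
        unfolding s_def by (rule left_inverse) (use pos in linarith)
      then have "(s - t) * norm (T w) = s * (norm (T w) - norm (T z))"
        using t by (simp add: algebra_simps)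
      then have "\<bar>(s - t) * norm (T w)\<bar> = \<bar>s * (norm (T w) - norm (T z))\<bar>"
        by simp
      with s(3) show ?thesis
        by (simp add: abs_mult)
    qed
    also have "\<dots> \<le> s * norm (T (z - w))"
      using s(3) by (intro mult_left_mono) (auto simp: T.diff norm_triangle_ineq3 norm_minus_commute)
    finally have st: "\<bar>s - t\<bar> * norm (T w) \<le> s * norm (T (z - w))" .
    have "T (s *\<^sub>R z - t *\<^sub>R w) = s *\<^sub>R T (z - w) + (s - t) *\<^sub>R T w"
      by (simp add: T.diff T.scaleR algebra_simps)
    then have "norm (T (s *\<^sub>R z - t *\<^sub>R w)) \<le> s * norm (T (z - w)) + \<bar>s - t\<bar> * norm (T w)"
      using norm_triangle_ineq[of "s *\<^sub>R T (z - w)" "(s - t) *\<^sub>R T w"] s(3) by simp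
    also have "\<dots> \<le> 2 * (s * norm (T (z - w)))"
      using st by simp
    also have "\<dots> \<le> 2 * (inverse c * (norm (z - w) * K))"
      using s c(1) K by (intro mult_left_mono mult_mono) auto
    finally show "dist (T z /\<^sub>R norm (T z)) (T w /\<^sub>R norm (T w)) \<le> 2 * K / c * dist z w"
      unfolding dist_norm eq using c(1) by (simp add: field_simps)
  qed
  with c(1) K(1) show ?thesis
    unfolding bilipschitz_on_def by (intro exI[of _ "c / (2 * K)"] conjI exI[of _ "2 * K / c"]) auto
qed

lemma bilipschitz_on_compose:
  assumes "bilipschitz_on S g" "bilipschitz_on S' h" "g ` S \<subseteq> S'"
  shows "bilipschitz_on S (\<lambda>x. h (g x))"
proof -
  obtain a b where ab: "a > 0" "b > 0" "\<And>x y. x \<in> S \<Longrightarrow> y \<in> S \<Longrightarrow>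
      a * dist x y \<le> dist (g x) (g y) \<and> dist (g x) (g y) \<le> b * dist x y"
    using assms(1) unfolding bilipschitz_on_def by blast
  obtain a' b' where ab': "a' > 0" "b' > 0" "\<And>x y. x \<in> S' \<Longrightarrow> y \<in> S' \<Longrightarrow>
      a' * dist x y \<le> dist (h x) (h y) \<and> dist (h x) (h y) \<le> b' * dist x y"
    using assms(2) unfolding bilipschitz_on_def by blast
  have "a' * a * dist x y \<le> dist (h (g x)) (h (g y)) \<and> dist (h (g x)) (h (g y)) \<le> b' * b * dist x y"
    if "x \<in> S" "y \<in> S" for x y
  proof -
    have "a' * (a * dist x y) \<le> a' * dist (g x) (g y)" "b' * dist (g x) (g y) \<le> b' * (b * dist x y)"
      using ab(3)[OF that] ab'(1,2) by simp_all
    moreover have "g x \<in> S'" "g y \<in> S'"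
      using assms(3) that by auto
    ultimately show ?thesis
      using ab'(3)[of "g x" "g y"] by (simp add: mult.assoc)
  qed
  moreover have "a' * a > 0" "b' * b > 0"
    using ab ab' by auto
  ultimately show ?thesis
    unfolding bilipschitz_on_def by blast
qed

section \<open>Rescaled lattice points in the face\<close>

text \<open>
  The lattice point \<open>y\<close> shrunk by the factor \<open>k\<close>.  Truncation at \<open>1\<close> keeps all of them in the face and
  does not increase distances; for fixed \<open>y\<close> it has no effect once \<open>k\<close> is large.  For \<open>k = 0\<close> the
  quotients are \<open>0\<close> by convention, which also gives a point of the face.
\<close>

lift_definition cube_point :: "nat \<Rightarrow> nat multiset \<Rightarrow> c0" is
  "\<lambda>k y i. case i of 0 \<Rightarrow> 1 | Suc j \<Rightarrow> min 1 (real (count y j) / real k)"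
proof -
  fix k :: nat and y :: "nat multiset"
  obtain m where m: "\<And>j. j \<in> set_mset y \<Longrightarrow> j < m"
    using finite_nat_bounded[of "set_mset y"] by auto
  have "\<forall>\<^sub>F i in sequentially. (case i of 0 \<Rightarrow> 1 | Suc j \<Rightarrow> min 1 (real (count y j) / real k)) = 0"
    using eventually_gt_at_top[of m]
  proof eventually_elim
    case (elim i)
    then obtain j where "i = Suc j" "m \<le> j"
      by (cases i) auto
    moreover from \<open>m \<le> j\<close> have "count y j = 0"
      using m[of j] by (meson count_inI not_less)
    ultimately show ?case
      by simp
  qed
  then show "(\<lambda>i. case i of 0 \<Rightarrow> 1 | Suc j \<Rightarrow> min 1 (real (count y j) / real k)) \<longlonglongrightarrow> 0"
    by (rule tendsto_eventually)
qed

lemma c0_nth_cube_point [simp]: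
  "c0_nth (cube_point k y) 0 = 1"
  "c0_nth (cube_point k y) (Suc j) = min 1 (real (count y j) / real k)"
  by (simp_all add: cube_point.rep_eq)

lemma cube_point_in_face: "cube_point k y \<in> c0_face"
proof -
  have "norm (cube_point k y) \<le> 1"
  proof (rule norm_c0_leI)
    show "\<bar>c0_nth (cube_point k y) n\<bar> \<le> 1" for n
      by (cases n) auto
  qed
  moreover have "1 \<le> norm (cube_point k y)"
    using c0_nth_le_norm[of "cube_point k y" 0] by simp
  ultimately show ?thesis
    by (simp add: c0_face_def)
qed

lemma dist_cube_point_le:
  assumes "\<And>i. count z i \<le> d"
  shows "real k * dist (cube_point k (y + z)) (cube_point k y) \<le> d"
proof (cases "k = 0")
  case False
  have trunc: "\<bar>min 1 (s + t) - min 1 s\<bar> \<le> r" if "0 \<le> t" "t \<le> r" for r s t :: real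
    using that by (auto simp: min_def)
  have "dist (cube_point k (y + z)) (cube_point k y) \<le> real d / real k"
    unfolding dist_norm
  proof (rule norm_c0_leI)
    fix n
    show "\<bar>c0_nth (cube_point k (y + z) - cube_point k y) n\<bar> \<le> real d / real k"
    proof (cases n)
      case (Suc j)
      have "real (count z j) / real k \<le> real d / real k"
        using assms by (intro divide_right_mono) auto
      moreover have "0 \<le> real (count z j) / real k"
        by simp
      ultimately show ?thesis
        using Suc trunc[of "real (count z j) / real k" "real d / real k" "real (count y j) / real k"]
        by (simp add: minus_c0.rep_eq add_divide_distrib)
    qed (simp add: minus_c0.rep_eq)
  qed
  with False show ?thesis
    by (simp add: field_simps)
qed simp

lemma sums_count_eq_sum_mset:
  fixes a :: "nat \<Rightarrow> real"
  shows "(\<lambda>n. a n * count y n) sums (\<Sum>i\<in>#y. a i)"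
proof (induction y)
  case (add x y)
  have "(\<lambda>n. (if n = x then a n else 0) + a n * count y n) sums (a x + (\<Sum>i\<in>#y. a i))"
    by (intro sums_add add sums_single)
  moreover have "(\<lambda>n. (if n = x then a n else 0) + a n * count y n) = (\<lambda>n. a n * count (add_mset x y) n)"
    by (auto simp: fun_eq_iff algebra_simps)
  ultimately show ?case
    by simp
qed simp

lemma ell1_c0_pairing_lipschitz:
  defines "pair \<equiv> \<lambda>w z. \<Sum>n. ell1_nth w n * c0_nth z (Suc n)"
  shows "\<bar>pair w z - pair w z'\<bar> \<le> norm w * norm (z - z')"
proof -
  have w: "summable (\<lambda>n. \<bar>ell1_nth w n\<bar>)"
    using ell1_nth[of w] by simp
  have s: "summable (\<lambda>n. \<bar>ell1_nth w n * c0_nth z (Suc n)\<bar>)" for z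
    by (rule summable_comparison_test'[OF summable_mult2[OF w, of "norm z"], of 0])
      (auto simp: abs_mult intro!: mult_left_mono c0_nth_le_norm)
  have "pair w z - pair w z' = (\<Sum>n. ell1_nth w n * c0_nth (z - z') (Suc n))"
    unfolding pair_def using suminf_diff[OF s[THEN summable_rabs_cancel] s[THEN summable_rabs_cancel]]
    by (simp add: minus_c0.rep_eq right_diff_distrib)
  also have "\<bar>\<dots>\<bar> \<le> (\<Sum>n. \<bar>ell1_nth w n * c0_nth (z - z') (Suc n)\<bar>)"
    by (rule summable_rabs[OF s])
  also have "\<dots> \<le> (\<Sum>n. \<bar>ell1_nth w n\<bar> * norm (z - z'))"
    by (intro suminf_le s summable_mult2 w) (auto simp: abs_mult intro!: mult_left_mono c0_nth_le_norm)
  also have "\<dots> = norm w * norm (z - z')"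
    by (simp add: norm_ell1_def suminf_mult2[OF w])
  finally show ?thesis .
qed

lemma pairing_cube_point:
  assumes "k > 0" "size y \<le> k"
  shows "(\<Sum>n. a n * c0_nth (cube_point k y) (Suc n)) = (\<Sum>i\<in>#y. a i) / k"
proof -
  have "count y n \<le> k" for n
    using count_le_size[of y n] assms(2) by linarith
  then have "a n * c0_nth (cube_point k y) (Suc n) = a n * count y n / k" for n
    using assms(1) by (simp add: min_absorb2)
  with sums_divide[OF sums_count_eq_sum_mset[of a y], of "real k"] show ?thesis
    by (simp add: sums_iff)
qed

section \<open>The surjection onto \<open>\<ell>\<^sub>1\<close>\<close>

lemma Lip0_imp_lipschitz:
  assumes "f \<in> Lip0 e"
  shows "(Lip f)-lipschitz_on UNIV f"
proof -
  obtain L where L: "L-lipschitz_on UNIV f"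
    using assms by (auto simp: Lip0_def)
  have *: "\<bar>f x - f y\<bar> / dist x y \<le> L" for x y
  proof (cases "x = y")
    case False
    then show ?thesis
      using lipschitz_onD[OF L, of x y] by (simp add: dist_real_def field_simps)
  qed (use lipschitz_on_nonneg[OF L] in simp)
  have up: "\<bar>f x - f y\<bar> / dist x y \<le> Lip f" for x y
    unfolding Lip_def
    using cSUP_upper[of "(x, y)" UNIV "\<lambda>(x, y). \<bar>f x - f y\<bar> / dist x y"] *
    by (auto simp: bdd_above_def)
  show ?thesis
  proof (rule lipschitz_onI)
    show "dist (f x) (f y) \<le> Lip f * dist x y" for x y
      using up[of x y] by (cases "x = y") (auto simp: dist_real_def field_simps)
    show "0 \<le> Lip f"
      using up[of e e] by simp
  qed
qed

lemma sum_abs_le_twice_subset_sums: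
  fixes a :: "nat \<Rightarrow> real"
  assumes "\<And>A. finite A \<Longrightarrow> \<bar>\<Sum>n\<in>A. a n\<bar> \<le> B" "finite A"
  shows "(\<Sum>n\<in>A. \<bar>a n\<bar>) \<le> 2 * B"
proof -
  let ?P = "{n \<in> A. 0 \<le> a n}" and ?N = "{n \<in> A. a n < 0}"
  have "A = ?P \<union> ?N"
    by auto
  then have "(\<Sum>n\<in>A. \<bar>a n\<bar>) = (\<Sum>n\<in>?P \<union> ?N. \<bar>a n\<bar>)"
    by simp
  also have "\<dots> = (\<Sum>n\<in>?P. \<bar>a n\<bar>) + (\<Sum>n\<in>?N. \<bar>a n\<bar>)"
    using assms(2) by (intro sum.union_disjoint) auto
  also have "\<dots> = (\<Sum>n\<in>?P. a n) - (\<Sum>n\<in>?N. a n)"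
    by (simp add: sum_negf)
  also have "\<dots> \<le> B + B"
    using assms(1)[of ?P] assms(1)[of ?N] assms(2) by (auto simp: abs_le_iff)
  finally show ?thesis
    by simp
qed

text \<open>
  A sequence \<open>w\<close> in \<open>\<ell>\<^sub>1\<close> acts on the face as a functional that is Lipschitz and affine along the
  lattice points.  Carried over to the image of the face and extended to all of the metric space, it
  becomes a Lipschitz function whose averaged partial derivatives are the entries of \<open>w\<close>.
\<close>

lemma Lip0_onto_ell1_if_c0_face_embeds:
  fixes e :: "'m::metric_space" and G :: "c0 \<Rightarrow> 'm"
  assumes "bilipschitz_on c0_face G"
  shows "\<exists>T :: ('m \<Rightarrow> real) \<Rightarrow> ell1. bounded_linear_Lip0 e T \<and> T ` Lip0 e = UNIV"
proof -
  obtain \<alpha> \<beta> where \<alpha>: "\<alpha> > 0" and \<beta>: "\<beta> > 0"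
    and G: "\<And>z w. z \<in> c0_face \<Longrightarrow> w \<in> c0_face \<Longrightarrow> \<alpha> * dist z w \<le> dist (G z) (G w)"
      "\<And>z w. z \<in> c0_face \<Longrightarrow> w \<in> c0_face \<Longrightarrow> dist (G z) (G w) \<le> \<beta> * dist z w"
    using assms unfolding bilipschitz_on_def by blast
  define p where "p k y = G (cube_point k y)" for k y
  have p: "real k * dist (p k (y + z)) (p k y) \<le> \<beta> * real d" if "\<And>i. count z i \<le> d" for k y z d
  proof -
    have "real k * dist (p k (y + z)) (p k y) \<le> real k * (\<beta> * dist (cube_point k (y + z)) (cube_point k y))"
      unfolding p_def by (intro mult_left_mono G(2) cube_point_in_face) auto
    also have "\<dots> = \<beta> * (real k * dist (cube_point k (y + z)) (cube_point k y))"
      by simp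
    also have "\<dots> \<le> \<beta> * real d"
      using \<beta> by (intro mult_left_mono dist_cube_point_le that) auto
    finally show ?thesis .
  qed
  obtain \<phi> :: "('m \<Rightarrow> real) \<Rightarrow> nat \<Rightarrow> real" where \<phi>:
    "\<And>K L f g n. K-lipschitz_on UNIV f \<Longrightarrow> L-lipschitz_on UNIV g \<Longrightarrow>
       \<phi> (\<lambda>x. f x + g x) n = \<phi> f n + \<phi> g n"
    "\<And>L c f n. L-lipschitz_on UNIV f \<Longrightarrow> \<phi> (\<lambda>x. c * f x) n = c * \<phi> f n"
    "\<And>L f A. L-lipschitz_on UNIV f \<Longrightarrow> finite A \<Longrightarrow> \<bar>\<Sum>n\<in>A. \<phi> f n\<bar> \<le> \<beta> * L"
    "\<And>f a b n. (\<And>y. \<forall>\<^sub>F k in sequentially. f (p k y) = b + (\<Sum>i\<in>#y. a i) / k) \<Longrightarrow>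
       \<phi> f n = a n"
    using asymptotic_gradient[of p \<beta>, OF p] by blast
  define T where "T f = Abs_ell1 (\<phi> f)" for f
  have abs_sum: "(\<Sum>n<m. \<bar>\<phi> f n\<bar>) \<le> 2 * (\<beta> * L)" if "L-lipschitz_on UNIV f" for L f m
    by (rule sum_abs_le_twice_subset_sums[OF \<phi>(3)[OF that]]) auto
  have summable: "summable (\<lambda>n. \<bar>\<phi> f n\<bar>)" if "L-lipschitz_on UNIV f" for L f
    by (rule bounded_imp_summable[OF abs_ge_zero]) (use abs_sum[OF that, of "Suc _"] in \<open>auto simp: lessThan_Suc_atMost\<close>)
  have nth_T: "ell1_nth (T f) = \<phi> f" if "L-lipschitz_on UNIV f" for L f
    using summable[OF that] by (simp add: T_def Abs_ell1_inverse)
  have "bounded_linear_Lip0 e T"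
    unfolding bounded_linear_Lip0_def
  proof (intro conjI ballI allI exI[of _ "2 * \<beta>"])
    fix f g :: "'m \<Rightarrow> real" assume "f \<in> Lip0 e" "g \<in> Lip0 e"
    note f = Lip0_imp_lipschitz[OF \<open>f \<in> Lip0 e\<close>] and g = Lip0_imp_lipschitz[OF \<open>g \<in> Lip0 e\<close>]
    have "ell1_nth (T (\<lambda>x. f x + g x)) = ell1_nth (T f + T g)"
      using nth_T[OF lipschitz_on_add[OF f g]] nth_T[OF f] nth_T[OF g] \<phi>(1)[OF f g]
      by (simp add: plus_ell1.rep_eq fun_eq_iff)
    then show "T (\<lambda>x. f x + g x) = T f + T g"
      by (simp add: ell1_nth_inject)
  next
    fix c and f :: "'m \<Rightarrow> real" assume "f \<in> Lip0 e"
    note f = Lip0_imp_lipschitz[OF \<open>f \<in> Lip0 e\<close>]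
    have "ell1_nth (T (\<lambda>x. c * f x)) = ell1_nth (c *\<^sub>R T f)"
      using nth_T[OF lipschitz_on_cmult_real[OF f, of c]] nth_T[OF f] \<phi>(2)[OF f]
      by (simp add: scaleR_ell1.rep_eq fun_eq_iff)
    then show "T (\<lambda>x. c * f x) = c *\<^sub>R T f"
      by (simp add: ell1_nth_inject)
  next
    fix f :: "'m \<Rightarrow> real" assume "f \<in> Lip0 e"
    note f = Lip0_imp_lipschitz[OF this]
    have "norm (T f) \<le> 2 * (\<beta> * Lip f)"
      unfolding norm_ell1_def nth_T[OF f] by (rule suminf_le_const[OF summable[OF f] abs_sum[OF f]])
    then show "norm (T f) \<le> Lip f * (2 * \<beta>)"
      by (simp add: mult_ac)
  qed
  moreover have "w \<in> T ` Lip0 e" for w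
  proof -
    define pair where "pair z = (\<Sum>n. ell1_nth w n * c0_nth z (Suc n))" for z
    define u where "u = pair \<circ> inv_into c0_face G"
    have "inj_on G c0_face"
      using G(1) \<alpha> by (intro inj_onI) (metis dist_self dist_le_zero_iff mult_le_0_iff not_less)
    then have u_G: "u (G z) = pair z" if "z \<in> c0_face" for z
      using that by (simp add: u_def)
    have "(norm w / \<alpha>)-lipschitz_on (G ` c0_face) u"
    proof (rule lipschitz_onI)
      fix x y assume "x \<in> G ` c0_face" "y \<in> G ` c0_face"
      then obtain z z' where z: "z \<in> c0_face" "z' \<in> c0_face" "x = G z" "y = G z'"
        by blast
      have "dist (u x) (u y) \<le> norm w * dist z z'"
        using ell1_c0_pairing_lipschitz[of w z z'] z u_G by (simp add: dist_norm pair_def)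
      also have "\<dots> \<le> norm w * (dist x y / \<alpha>)"
        using G(1)[OF z(1,2)] z(3,4) \<alpha> by (intro mult_left_mono) (auto simp: field_simps)
      finally show "dist (u x) (u y) \<le> norm w / \<alpha> * dist x y"
        by simp
    qed (use \<alpha> in simp)
    then obtain g where g: "(norm w / \<alpha>)-lipschitz_on UNIV g" "\<And>x. x \<in> G ` c0_face \<Longrightarrow> g x = u x"
      using lipschitz_extension_real by blast
    define f where "f x = g x - g e" for x
    have f: "(norm w / \<alpha>)-lipschitz_on UNIV f"
      using g(1) by (simp add: lipschitz_on_def f_def dist_norm)
    then have "f \<in> Lip0 e"
      by (auto simp: Lip0_def f_def)
    moreover have "\<phi> f n = ell1_nth w n" for n
    proof (rule \<phi>(4))
      fix y
      show "\<forall>\<^sub>F k in sequentially. f (p k y) = - g e + (\<Sum>i\<in>#y. ell1_nth w i) / k"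
        using eventually_gt_at_top[of 0] eventually_ge_at_top[of "size y"]
      proof eventually_elim
        case (elim k)
        have "g (p k y) = pair (cube_point k y)"
          unfolding p_def using g(2) u_G cube_point_in_face by auto
        also have "\<dots> = (\<Sum>i\<in>#y. ell1_nth w i) / k"
          unfolding pair_def using elim by (rule pairing_cube_point)
        finally show ?case
          by (simp add: f_def)
      qed
    qed
    then have "T f = w"
      by (metis T_def ell1_nth_inverse ext)
    ultimately show ?thesis
      by blast
  qed
  ultimately show ?thesis
    by blast
qed

theorem theorem5p6:
  fixes e :: "'m::metric_space"
  assumes "separable_space (euclidean :: 'e::banach topology)"
    and "absolute_lipschitz_retract (euclidean_metric :: 'e metric)"
    and "contains_isomorphic_copy_c0 TYPE('e)"
    and "\<exists>h :: 'e \<Rightarrow> 'm. bilipschitz_on (sphere 0 1) h"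
  shows "\<exists>T :: ('m \<Rightarrow> real) \<Rightarrow> ell1. bounded_linear_Lip0 e T \<and> T ` Lip0 e = UNIV"
proof -
  obtain h :: "'e \<Rightarrow> 'm" where h: "bilipschitz_on (sphere 0 1) h"
    using assms(4) by blast
  obtain J :: "c0 \<Rightarrow> 'e" and S where J: "bounded_linear J" "homeomorphism UNIV (range J) J S"
    using assms(3) by (auto simp: contains_isomorphic_copy_c0_def)
  obtain c where c: "c > 0" "\<And>x. c * norm x \<le> norm (J x)"
    using bounded_linear_homeomorphism_bounded_below[OF J] by blast
  have "J z \<noteq> 0" if "z \<in> c0_face" for z
    using c(1) c(2)[of z] that by (auto simp: c0_face_def)
  then have "(\<lambda>z. J z /\<^sub>R norm (J z)) ` c0_face \<subseteq> sphere 0 1"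
    by auto
  from bilipschitz_on_compose[OF bilipschitz_on_normalized_c0_face[OF J(1) c] h this]
  show ?thesis
    by (rule Lip0_onto_ell1_if_c0_face_embeds)
qed

end
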